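(* Let $\mathcal{A}$ and $\mathcal{U}$ be Banach algebras such that $\mathcal{U}$ is a Banach $\mathcal{A}$-bimodule with compatible actions and norm. Assume that every derivation $D$ on $\mathcal{A}\ltimes\mathcal{U}$ satisfies $D(\{0\}\times\mathcal{U})\subseteq\{0\}\times\mathcal{U}$. Suppose that for every $\delta_1\in Z^1(\mathcal{A})$ and $\delta_2\in Z^1(\mathcal{A},\mathcal{U})$ we have $\delta_1(\mathcal{A})\subseteq ann_{\mathcal{A}}\mathcal{U}$ and $\delta_2(\mathcal{A})\subseteq ann_{\mathcal{U}}\mathcal{U}$ (so that $R_{\mathcal{A}}(\mathcal{U})+N^1(\mathcal{U})\subseteq Hom_{\mathcal{A}}(\mathcal{U})\cap Z^1(\mathcal{U})$). Suppose further that $$\frac{Hom_{\mathcal{A}}(\mathcal{U})\cap Z^1(\mathcal{U})}{R_{\mathcal{A}}(\mathcal{U})+N^1(\mathcal{U})}=(0).$$ Then there is a linear isomorphism $$H^1(\mathcal{A}\ltimes\mathcal{U})\cong\frac{Z^1(\mathcal{A})\times Z^1(\mathcal{A},\mathcal{U})}{\mathcal{K}},$$ where $\mathcal{K}$ is the following linear subspace of $Z^1(\mathcal{A})\times Z^1(\mathcal{A},\mathcal{U})$: $$\mathcal{K}=\{(id_a,\ id_{\mathcal{A},x})\mid a\in\mathcal{A},\ x\in\mathcal{U},\ r_a+id_{\mathcal{U},x}=0\}.$$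
   Context: All algebras are over $\mathbb{C}$. "Banach $\mathcal{A}$-bimodule with compatible actions and norm" means: $\|ax\|\le\|a\|\|x\|$, $\|xa\|\le\|x\|\|a\|$, and $a(xy)=(ax)y$, $(xy)a=x(ya)$, $(xa)y=x(ay)$ for all $a\in\mathcal{A}$, $x,y\in\mathcal{U}$. The semidirect product $\mathcal{A}\ltimes\mathcal{U}$ is $\mathcal{A}\times\mathcal{U}$ with multiplication $(a,x)(b,y)=(ab,\,ay+xb+xy)$ and norm $\|(a,x)\|=\|a\|+\|x\|$. For a Banach algebra $\mathcal{B}$ and a Banach $\mathcal{B}$-bimodule $\mathcal{X}$, a derivation $\delta:\mathcal{B}\to\mathcal{X}$ is a linear map with $\delta(bc)=b\delta(c)+\delta(b)c$; inner derivations are the maps $b\mapsto bx-xb$ with $x\in\mathcal{X}$; $Z^1(\mathcal{B},\mathcal{X})$ is the space of continuous derivations, $N^1(\mathcal{B},\mathcal{X})$ the space of inner derivations, $H^1(\mathcal{B},\mathcal{X})=Z^1(\mathcal{B},\mathcal{X})/N^1(\mathcal{B},\mathcal{X})$; write $Z^1(\mathcal{B}),N^1(\mathcal{B}),H^1(\mathcal{B})$ when $\mathcal{X}=\mathcal{B}$. $Hom_{\mathcal{A}}(\mathcal{U})$ is the space of continuous $\mathcal{A}$-bimodule homomorphisms $\mathcal{U}\to\mathcal{U}$. $ann_{\mathcal{A}}\mathcal{U}=\{a\in\mathcal{A}\mid a\mathcal{U}=\mathcal{U}a=(0)\}$, $ann_{\mathcal{U}}\mathcal{U}=\{x\in\mathcal{U}\mid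 x\mathcal{U}=\mathcal{U}x=(0)\}$. Notation: $id_a(b)=ba-ab$ ($b\in\mathcal{A}$); $id_{\mathcal{A},x}:\mathcal{A}\to\mathcal{U}$, $id_{\mathcal{A},x}(b)=bx-xb$; $id_{\mathcal{U},x}:\mathcal{U}\to\mathcal{U}$, $id_{\mathcal{U},x}(y)=yx-xy$; $r_a:\mathcal{U}\to\mathcal{U}$, $r_a(y)=ya-ay$; $R_{\mathcal{A}}(\mathcal{U})=\{r_a\mid a\in\mathcal{A}\}$. The symbol $\cong$ denotes isomorphism of linear spaces. *)

theory Defs
  imports
    "HOL-Analysis.Analysis"
    "HOL-Library.Function_Algebras"
    "HOL-Library.Set_Algebras"
begin

section \<open>Complex vector spaces and Banach algebras\<close>

class scaleC =
  fixes scaleC :: "complex \<Rightarrow> 'a \<Rightarrow> 'a"  (infixr \<open>*\<^sub>C\<close> 75)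

class complex_vector = scaleC + ab_group_add +
  assumes scaleC_add_right: "a *\<^sub>C (x + y) = a *\<^sub>C x + a *\<^sub>C y"
    and scaleC_add_left: "(a + b) *\<^sub>C x = a *\<^sub>C x + b *\<^sub>C x"
    and scaleC_scaleC: "a *\<^sub>C b *\<^sub>C x = (a * b) *\<^sub>C x"
    and scaleC_one: "1 *\<^sub>C x = x"

class complex_normed_vector = complex_vector + real_normed_vector +
  assumes scaleR_scaleC: "r *\<^sub>R x = complex_of_real r *\<^sub>C x"
    and norm_scaleC: "norm (a *\<^sub>C x) = cmod a * norm x"

text \<open>Algebras are not assumed to have a unit.\<close>

class complex_banach_algebra = complex_normed_vector + real_normed_algebra + banach +
  assumes mult_scaleC_left: "(a *\<^sub>C x) * y = a *\<^sub>C (x * y)"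
    and mult_scaleC_right: "x * (a *\<^sub>C y) = a *\<^sub>C (x * y)"

global_interpretation complex_vector: vector_space "scaleC :: complex \<Rightarrow> 'a::complex_vector \<Rightarrow> 'a"
  by unfold_locales
    (simp_all add: scaleC_add_right scaleC_add_left scaleC_scaleC scaleC_one)

abbreviation csubspace :: "'a::complex_vector set \<Rightarrow> bool"
  where "csubspace \<equiv> module.subspace scaleC"

abbreviation clinear :: "('a::complex_vector \<Rightarrow> 'b::complex_vector) \<Rightarrow> bool"
  where "clinear \<equiv> Vector_Spaces.linear scaleC scaleC"

instantiation "fun" :: (type, complex_vector) complex_vector
begin
definition scaleC_fun_def: "c *\<^sub>C f = (\<lambda>x. c *\<^sub>C f x)"
instance
  by standard
    (simp_all add: scaleC_fun_def fun_eq_iff scaleC_add_right scaleC_add_left scaleC_scaleC scaleC_one)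
end

instantiation prod :: (complex_vector, complex_vector) complex_vector
begin
definition scaleC_prod_def: "c *\<^sub>C p = (c *\<^sub>C fst p, c *\<^sub>C snd p)"
instance
  by standard
    (simp_all add: scaleC_prod_def prod_eq_iff scaleC_add_right scaleC_add_left scaleC_scaleC scaleC_one)
end


section \<open>Quotient spaces and linear isomorphism\<close>

record 'v linspace =
  points :: "'v set"
  vadd :: "'v \<Rightarrow> 'v \<Rightarrow> 'v"
  vscale :: "complex \<Rightarrow> 'v \<Rightarrow> 'v"

definition linear_isomorphic :: "'v linspace \<Rightarrow> 'w linspace \<Rightarrow> bool"  (infix \<open>\<cong>\<^sub>C\<close> 50)
  where "V \<cong>\<^sub>C W \<longleftrightarrow> (\<exists>\<Phi>. bij_betw \<Phi> (points V) (points W)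
    \<and> (\<forall>u\<in>points V. \<forall>v\<in>points V. \<Phi> (vadd V u v) = vadd W (\<Phi> u) (\<Phi> v))
    \<and> (\<forall>c. \<forall>v\<in>points V. \<Phi> (vscale V c v) = vscale W c (\<Phi> v)))"

text \<open>The operations on cosets are written as unions over all representatives; for a subspace
  \<open>N\<close> each union consists of a single coset, see the two lemmas below.\<close>

definition quotient_space :: "'v::complex_vector set \<Rightarrow> 'v set \<Rightarrow> 'v set linspace"  (infixl \<open>'/\<^sub>q\<close> 70)
  where "V /\<^sub>q N = \<lparr>points = (\<lambda>v. v +o N) ` V,
    vadd = (\<lambda>X Y. \<Union>x\<in>X. \<Union>y\<in>Y. (x + y) +o N),
    vscale = (\<lambda>c X. \<Union>x\<in>X. (c *\<^sub>C x) +o N)\<rparr>"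

lemma coset_eq_iff:
  assumes "csubspace N"
  shows "u +o N = v +o N \<longleftrightarrow> u - v \<in> N"
proof
  assume "u +o N = v +o N"
  moreover have "u \<in> u +o N"
    using complex_vector.subspace_0[OF assms] by (force simp: elt_set_plus_def)
  ultimately show "u - v \<in> N" by (auto simp: elt_set_plus_def)
next
  assume *: "u - v \<in> N"
  have "u + n = v + ((u - v) + n)" "v + n = u + (n - (u - v))" for n by simp_all
  then show "u +o N = v +o N"
    using complex_vector.subspace_add[OF assms *] complex_vector.subspace_diff[OF assms _ *]
    unfolding elt_set_plus_def by blast
qed

lemma mem_coset_iff: "x \<in> v +o N \<longleftrightarrow> x - v \<in> (N :: 'v::ab_group_add set)"
proof
  assume "x - v \<in> N"
  then show "x \<in> v +o N" by (intro set_plus_intro2[of "x - v" N v, simplified])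
qed (auto simp: elt_set_plus_def)

lemma vadd_quotient_space:
  assumes "csubspace N"
  shows "vadd (V /\<^sub>q N) (u +o N) (v +o N) = (u + v) +o N"
proof -
  have eq: "(x + y) +o N = (u + v) +o N" if "x \<in> u +o N" "y \<in> v +o N" for x y
  proof -
    have "x + y - (u + v) = (x - u) + (y - v)" by simp
    then show ?thesis
      using that complex_vector.subspace_add[OF assms, of "x - u" "y - v"]
      by (simp only: coset_eq_iff[OF assms] mem_coset_iff)
  qed
  have mem: "u \<in> u +o N" "v \<in> v +o N"
    using complex_vector.subspace_0[OF assms] by (simp_all add: mem_coset_iff)
  have "(\<Union>x\<in>u +o N. \<Union>y\<in>v +o N. (x + y) +o N) = (u + v) +o N"
    using eq mem by blast
  then show ?thesis
    by (simp only: quotient_space_def linspace.select_convs)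
qed

lemma vscale_quotient_space:
  assumes "csubspace N"
  shows "vscale (V /\<^sub>q N) c (v +o N) = (c *\<^sub>C v) +o N"
proof -
  have eq: "(c *\<^sub>C x) +o N = (c *\<^sub>C v) +o N" if "x \<in> v +o N" for x
  proof -
    have "c *\<^sub>C x - c *\<^sub>C v = c *\<^sub>C (x - v)"
      by (simp only: complex_vector.scale_right_diff_distrib)
    then show ?thesis
      using that complex_vector.subspace_scale[OF assms, of "x - v" c]
      by (simp only: coset_eq_iff[OF assms] mem_coset_iff)
  qed
  have mem: "v \<in> v +o N"
    using complex_vector.subspace_0[OF assms] by (simp add: mem_coset_iff)
  have "(\<Union>x\<in>v +o N. (c *\<^sub>C x) +o N) = (c *\<^sub>C v) +o N"
    using eq mem by blast
  then show ?thesis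
    by (simp only: quotient_space_def linspace.select_convs)
qed


section \<open>Derivations\<close>

text \<open>The algebra multiplication and the module actions are explicit arguments, because the
  multiplication of a semidirect product depends on the actions. For an algebra acting on itself
  all of them are the multiplication.\<close>

definition derivation ::
  "('b \<Rightarrow> 'b \<Rightarrow> 'b) \<Rightarrow> ('b \<Rightarrow> 'x \<Rightarrow> 'x) \<Rightarrow> ('x \<Rightarrow> 'b \<Rightarrow> 'x)
    \<Rightarrow> ('b::complex_vector \<Rightarrow> 'x::complex_vector) \<Rightarrow> bool"
  where "derivation m l r D \<longleftrightarrow> clinear D \<and> (\<forall>b c. D (m b c) = l b (D c) + r (D b) c)"

definition inner_derivation ::
  "('b \<Rightarrow> 'x \<Rightarrow> 'x) \<Rightarrow> ('x \<Rightarrow> 'b \<Rightarrow> 'x) \<Rightarrow> 'x \<Rightarrow> 'b \<Rightarrow> 'x::complex_vector"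
  where "inner_derivation l r x = (\<lambda>b. l b x - r x b)"

definition Z1 ::
  "('b \<Rightarrow> 'b \<Rightarrow> 'b) \<Rightarrow> ('b \<Rightarrow> 'x \<Rightarrow> 'x) \<Rightarrow> ('x \<Rightarrow> 'b \<Rightarrow> 'x)
    \<Rightarrow> ('b::complex_normed_vector \<Rightarrow> 'x::complex_normed_vector) set"
  where "Z1 m l r = {D. derivation m l r D \<and> continuous_on UNIV D}"

definition N1 ::
  "('b \<Rightarrow> 'x \<Rightarrow> 'x) \<Rightarrow> ('x \<Rightarrow> 'b \<Rightarrow> 'x) \<Rightarrow> ('b \<Rightarrow> 'x::complex_vector) set"
  where "N1 l r = range (inner_derivation l r)"

definition H1 ::
  "('b \<Rightarrow> 'b \<Rightarrow> 'b) \<Rightarrow> ('b \<Rightarrow> 'x \<Rightarrow> 'x) \<Rightarrow> ('x \<Rightarrow> 'b \<Rightarrow> 'x)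
    \<Rightarrow> ('b::complex_normed_vector \<Rightarrow> 'x::complex_normed_vector) set linspace"
  where "H1 m l r = Z1 m l r /\<^sub>q N1 l r"


section \<open>Compatible Banach bimodules\<close>

locale banach_bimodule =
  fixes l :: "'a::complex_banach_algebra \<Rightarrow> 'u \<Rightarrow> 'u::{complex_normed_vector, banach}"
    and r :: "'u \<Rightarrow> 'a \<Rightarrow> 'u"
  assumes clinear_l1: "clinear (\<lambda>a. l a x)"
    and clinear_l2: "clinear (\<lambda>x. l a x)"
    and clinear_r1: "clinear (\<lambda>x. r x a)"
    and clinear_r2: "clinear (\<lambda>a. r x a)"
    and l_mult: "l (a * b) x = l a (l b x)"
    and r_mult: "r x (a * b) = r (r x a) b"
    and l_r: "l a (r x b) = r (l a x) b"
    and norm_l: "norm (l a x) \<le> norm a * norm x"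
    and norm_r: "norm (r x a) \<le> norm x * norm a"

locale compatible_banach_bimodule = banach_bimodule l r
  for l :: "'a::complex_banach_algebra \<Rightarrow> 'u \<Rightarrow> 'u::complex_banach_algebra"
    and r :: "'u \<Rightarrow> 'a \<Rightarrow> 'u" +
  assumes l_times: "l a (x * y) = l a x * y"
    and times_r: "r (x * y) a = x * r y a"
    and r_times_l: "r x a * y = x * l a y"

definition Hom_bimod ::
  "('a \<Rightarrow> 'u \<Rightarrow> 'u) \<Rightarrow> ('u \<Rightarrow> 'a \<Rightarrow> 'u) \<Rightarrow> ('u::complex_normed_vector \<Rightarrow> 'u) set"
  where "Hom_bimod l r = {T. clinear T \<and> continuous_on UNIV T
    \<and> (\<forall>a x. T (l a x) = l a (T x)) \<and> (\<forall>a x. T (r x a) = r (T x) a)}"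

definition ann_alg ::
  "('a \<Rightarrow> 'u \<Rightarrow> 'u) \<Rightarrow> ('u \<Rightarrow> 'a \<Rightarrow> 'u::complex_vector) \<Rightarrow> 'a set"
  where "ann_alg l r = {a. \<forall>x. l a x = 0 \<and> r x a = 0}"

definition ann_self :: "'u::complex_banach_algebra set"
  where "ann_self = {x. \<forall>y. x * y = 0 \<and> y * x = 0}"

definition r_map ::
  "('a \<Rightarrow> 'u \<Rightarrow> 'u) \<Rightarrow> ('u \<Rightarrow> 'a \<Rightarrow> 'u) \<Rightarrow> 'a \<Rightarrow> 'u \<Rightarrow> 'u::complex_vector"
  where "r_map l r a = (\<lambda>y. r y a - l a y)"

definition R_maps ::
  "('a \<Rightarrow> 'u \<Rightarrow> 'u) \<Rightarrow> ('u \<Rightarrow> 'a \<Rightarrow> 'u) \<Rightarrow> ('u \<Rightarrow> 'u::complex_vector) set"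
  where "R_maps l r = range (r_map l r)"


section \<open>The semidirect product\<close>

text \<open>A copy of the product type is needed because the library already equips pairs with the
  Euclidean norm, whereas the semidirect product carries the norm \<open>\<parallel>a\<parallel> + \<parallel>x\<parallel>\<close>.\<close>

datatype ('a, 'u) semidirect = SD (alg_part: 'a) (mod_part: 'u)

instantiation semidirect :: (complex_normed_vector, complex_normed_vector) complex_normed_vector
begin

definition zero_semidirect_def: "0 = SD 0 0"
definition plus_semidirect_def:
  "p + q = SD (alg_part p + alg_part q) (mod_part p + mod_part q)"
definition minus_semidirect_def:
  "p - q = SD (alg_part p - alg_part q) (mod_part p - mod_part q)"
definition uminus_semidirect_def: "- p = SD (- alg_part p) (- mod_part p)"
definition scaleC_semidirect_def: "c *\<^sub>C p = SD (c *\<^sub>C alg_part p) (c *\<^sub>C mod_part p)"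
definition scaleR_semidirect_def: "c *\<^sub>R p = SD (c *\<^sub>R alg_part p) (c *\<^sub>R mod_part p)"
definition norm_semidirect_def: "norm p = norm (alg_part p) + norm (mod_part p)"
definition sgn_semidirect_def: "sgn (p :: ('a, 'b) semidirect) = inverse (norm p) *\<^sub>R p"
definition dist_semidirect_def: "dist p q = norm (p - q :: ('a, 'b) semidirect)"
definition uniformity_semidirect_def:
  "(uniformity :: (('a, 'b) semidirect \<times> ('a, 'b) semidirect) filter)
    = (INF e\<in>{0<..}. principal {(p, q). dist p q < e})"
definition open_semidirect_def:
  "open (U :: ('a, 'b) semidirect set)
    \<longleftrightarrow> (\<forall>p\<in>U. \<forall>\<^sub>F (p', q) in uniformity. p' = p \<longrightarrow> q \<in> U)"

instance
proof
  fix p q s :: "('a, 'b) semidirect" and a b :: complex and c d :: real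
  note ops = zero_semidirect_def plus_semidirect_def minus_semidirect_def uminus_semidirect_def
    scaleC_semidirect_def scaleR_semidirect_def norm_semidirect_def
  show "p + q + s = p + (q + s)" "p + q = q + p" "0 + p = p" "- p + p = 0" "p - q = p + - q"
    by (simp_all add: ops)
  show "a *\<^sub>C (p + q) = a *\<^sub>C p + a *\<^sub>C q" "(a + b) *\<^sub>C p = a *\<^sub>C p + b *\<^sub>C p"
    "a *\<^sub>C b *\<^sub>C p = (a * b) *\<^sub>C p" "1 *\<^sub>C p = p"
    by (simp_all add: ops scaleC_add_right scaleC_add_left scaleC_scaleC scaleC_one)
  show "c *\<^sub>R (p + q) = c *\<^sub>R p + c *\<^sub>R q" "(c + d) *\<^sub>R p = c *\<^sub>R p + d *\<^sub>R p"
    "c *\<^sub>R d *\<^sub>R p = (c * d) *\<^sub>R p" "1 *\<^sub>R p = p"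
    by (simp_all add: ops scaleR_add_right scaleR_add_left)
  show "c *\<^sub>R p = complex_of_real c *\<^sub>C p"
    by (simp add: ops scaleR_scaleC)
  show "norm (a *\<^sub>C p) = cmod a * norm p" "norm (c *\<^sub>R p) = \<bar>c\<bar> * norm p"
    by (simp_all add: ops norm_scaleC distrib_left)
  show "norm p = 0 \<longleftrightarrow> p = 0"
    by (cases p) (simp add: ops add_nonneg_eq_0_iff)
  show "norm (p + q) \<le> norm p + norm q"
    using norm_triangle_ineq[of "alg_part p" "alg_part q"]
      norm_triangle_ineq[of "mod_part p" "mod_part q"]
    by (simp add: ops)
qed (rule sgn_semidirect_def dist_semidirect_def uniformity_semidirect_def open_semidirect_def)+

end

instance semidirect ::
  ("{complex_normed_vector, banach}", "{complex_normed_vector, banach}") banach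
proof
  fix X :: "nat \<Rightarrow> ('a, 'b) semidirect"
  assume X: "Cauchy X"
  have norm: "norm (p - q) = norm (alg_part p - alg_part q) + norm (mod_part p - mod_part q)"
    for p q :: "('a, 'b) semidirect"
    by (simp add: norm_semidirect_def minus_semidirect_def)
  have "dist (alg_part p) (alg_part q) \<le> dist p q" "dist (mod_part p) (mod_part q) \<le> dist p q"
    for p q :: "('a, 'b) semidirect"
    by (simp_all add: dist_norm norm)
  then have "Cauchy (\<lambda>n. alg_part (X n))" "Cauchy (\<lambda>n. mod_part (X n))"
    using X unfolding Cauchy_def by (meson le_less_trans)+
  then obtain a x where lim: "(\<lambda>n. alg_part (X n)) \<longlonglongrightarrow> a" "(\<lambda>n. mod_part (X n)) \<longlonglongrightarrow> x"
    by (auto simp: Cauchy_convergent_iff convergent_def)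
  have "(\<lambda>n. norm (alg_part (X n) - a) + norm (mod_part (X n) - x)) \<longlonglongrightarrow> 0 + 0"
    by (intro tendsto_add tendsto_norm_zero LIM_zero lim)
  then have "(\<lambda>n. norm (X n - SD a x)) \<longlonglongrightarrow> 0"
    by (simp add: norm)
  then show "convergent X"
    by (auto simp: convergent_def tendsto_norm_zero_iff LIM_zero_iff)
qed

definition sd_mult ::
  "('a \<Rightarrow> 'u \<Rightarrow> 'u) \<Rightarrow> ('u \<Rightarrow> 'a \<Rightarrow> 'u)
    \<Rightarrow> ('a::complex_banach_algebra, 'u::complex_banach_algebra) semidirect
    \<Rightarrow> ('a, 'u) semidirect \<Rightarrow> ('a, 'u) semidirect"
  where "sd_mult l r p q = SD (alg_part p * alg_part q)
    (l (alg_part p) (mod_part q) + r (mod_part p) (alg_part q) + mod_part p * mod_part q)"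

abbreviation derivation_sd ::
  "('a \<Rightarrow> 'u \<Rightarrow> 'u) \<Rightarrow> ('u \<Rightarrow> 'a \<Rightarrow> 'u)
    \<Rightarrow> (('a::complex_banach_algebra, 'u::complex_banach_algebra) semidirect
      \<Rightarrow> ('a, 'u) semidirect) \<Rightarrow> bool"
  where "derivation_sd l r \<equiv> derivation (sd_mult l r) (sd_mult l r) (sd_mult l r)"

abbreviation H1_sd ::
  "('a \<Rightarrow> 'u \<Rightarrow> 'u) \<Rightarrow> ('u \<Rightarrow> 'a \<Rightarrow> 'u)
    \<Rightarrow> (('a::complex_banach_algebra, 'u::complex_banach_algebra) semidirect
      \<Rightarrow> ('a, 'u) semidirect) set linspace"
  where "H1_sd l r \<equiv> H1 (sd_mult l r) (sd_mult l r) (sd_mult l r)"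

abbreviation Z1_self :: "('b::complex_banach_algebra \<Rightarrow> 'b) set"
  where "Z1_self \<equiv> Z1 (*) (*) (*)"

abbreviation N1_self :: "('b::complex_banach_algebra \<Rightarrow> 'b) set"
  where "N1_self \<equiv> N1 (*) (*)"

definition K_space ::
  "('a \<Rightarrow> 'u \<Rightarrow> 'u) \<Rightarrow> ('u \<Rightarrow> 'a \<Rightarrow> 'u)
    \<Rightarrow> (('a::complex_banach_algebra \<Rightarrow> 'a) \<times> ('a \<Rightarrow> 'u::complex_banach_algebra)) set"
  where "K_space l r = {(inner_derivation (*) (*) a, inner_derivation l r x) | a x.
    r_map l r a + inner_derivation (*) (*) x = 0}"

context compatible_banach_bimodule
begin

lemma sd_mult_assoc: "sd_mult l r (sd_mult l r p q) s = sd_mult l r p (sd_mult l r q s)"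
proof -
  have "l a (x + y) = l a x + l a y" "r (x + y) a = r x a + r y a" for a x y
    using clinear_l2 clinear_r1
    by (simp_all add: Vector_Spaces.linear_iff)
  then show ?thesis
    by (simp add: sd_mult_def algebra_simps l_mult r_mult l_r l_times times_r r_times_l)
qed

lemma norm_sd_mult: "norm (sd_mult l r p q) \<le> norm p * norm q"
proof -
  obtain a x b y where "p = SD a x" "q = SD b y"
    by (metis semidirect.exhaust)
  moreover have "norm (l a y + r x b + x * y)
      \<le> norm a * norm y + norm x * norm b + norm x * norm y"
    by (intro norm_triangle_mono norm_l norm_r norm_mult_ineq)
  moreover note norm_mult_ineq[of a b]
  ultimately show ?thesis
    by (simp add: sd_mult_def norm_semidirect_def algebra_simps)
qed

end

end

theory Submission
  imports Defs
begin

text \<open>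
  A linear map of \<open>\<A> \<ltimes> \<U>\<close> into itself that preserves the ideal \<open>{0} \<times> \<U>\<close> is a lower triangular matrix
  \<open>(a, x) \<mapsto> (\<delta>\<^sub>1 a, \<delta>\<^sub>2 a + \<tau> x)\<close>. It is a derivation iff \<open>\<delta>\<^sub>1\<close>, \<open>\<delta>\<^sub>2\<close> and \<open>\<tau>\<close> are derivations and \<open>\<tau>\<close>
  fails to be a bimodule homomorphism precisely by the action of the values of \<open>\<delta>\<^sub>1\<close> and \<open>\<delta>\<^sub>2\<close> on
  \<open>\<U>\<close> (\<open>derivation_sd_map_iff\<close>). When these values annihilate \<open>\<U>\<close>, the three entries decouple:
  \<open>Z\<^sup>1(\<A> \<ltimes> \<U>)\<close> is the product of \<open>Z\<^sup>1(\<A>)\<close>, \<open>Z\<^sup>1(\<A>, \<U>)\<close> and \<open>Hom(\<U>) \<inter> Z\<^sup>1(\<U>)\<close>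
  (\<open>sd_map_in_Z1_iff\<close>).

  The inner derivation given by \<open>(a, x)\<close> has the entries \<open>id\<^sub>a\<close>, \<open>id\<^sub>x\<close> on \<open>\<A>\<close>, and \<open>r\<^sub>a + id\<^sub>x\<close> on \<open>\<U>\<close>
  (\<open>inner_derivation_sd\<close>). If every possible \<open>\<tau>\<close> is of the form \<open>r\<^sub>a + id\<^sub>x\<close>, then subtracting the
  inner derivation given by \<open>(a, x)\<close> removes the entry \<open>\<tau>\<close>. So every cohomology class contains a
  derivation with \<open>\<tau> = 0\<close>, that is, an element of \<open>Z\<^sup>1(\<A>) \<times> Z\<^sup>1(\<A>, \<U>)\<close>. A derivation with \<open>\<tau> = 0\<close>
  is inner iff it is given by some \<open>(a, x)\<close> with \<open>r\<^sub>a + id\<^sub>x = 0\<close>, which is membership in \<open>\<K>\<close>. The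
  isomorphism then comes from the homomorphism theorem in the form
  \<open>quotient_space_isomorphic_preimage\<close>, applied to the embedding of pairs as the derivations with
  \<open>\<tau> = 0\<close>.
\<close>

section \<open>Linear maps and quotient spaces\<close>

lemma clinear_iff:
  "clinear f \<longleftrightarrow> (\<forall>x y. f (x + y) = f x + f y) \<and> (\<forall>c x. f (c *\<^sub>C x) = c *\<^sub>C f x)"
  by (simp add: Vector_Spaces.linear_iff complex_vector.vector_space_axioms)

lemma clinear_0: "clinear f \<Longrightarrow> f 0 = 0"
  unfolding clinear_iff by (metis add_cancel_right_left)

lemma clinear_diff: "clinear f \<Longrightarrow> f (x - y) = f x - f y"
  unfolding clinear_iff by (metis add_diff_cancel_right' diff_add_cancel)

lemma csubspace_iff:
  "csubspace S \<longleftrightarrow> 0 \<in> S \<and> (\<forall>x\<in>S. \<forall>y\<in>S. x + y \<in> S) \<and> (\<forall>c. \<forall>x\<in>S. c *\<^sub>C x \<in> S)"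
  by (rule complex_vector.subspace_def)

lemma csubspace_range:
  assumes f: "clinear f"
  shows "csubspace (range f)"
proof -
  have "f 0 = 0" "f x + f y = f (x + y)" "c *\<^sub>C f x = f (c *\<^sub>C x)" for x y c
    using f clinear_0[OF f] by (simp_all add: clinear_iff)
  then show ?thesis
    unfolding csubspace_iff by (auto intro: range_eqI[of _ _ 0])
qed

lemma csubspace_preimage:
  assumes "clinear f" "csubspace S" "csubspace V"
  shows "csubspace {v \<in> V. f v \<in> S}"
  using assms clinear_0[OF assms(1)] by (simp add: csubspace_iff clinear_iff)

lemma csubspace_Times: "csubspace S \<Longrightarrow> csubspace T \<Longrightarrow> csubspace (S \<times> T)"
  by (auto simp: csubspace_iff zero_prod_def scaleC_prod_def)

lemma continuous_on_clinear:
  fixes f :: "'a::complex_normed_vector \<Rightarrow> 'b::complex_normed_vector"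
  assumes f: "clinear f" and bound: "\<And>x. norm (f x) \<le> norm x * K"
  shows "continuous_on S f"
proof -
  have "bounded_linear f"
    using f bound by (intro bounded_linear_intro[of f K]) (simp_all add: clinear_iff scaleR_scaleC)
  then show ?thesis
    by (intro linear_continuous_on)
qed

lemma continuous_on_scaleC:
  fixes f :: "'a::complex_normed_vector \<Rightarrow> 'b::complex_normed_vector"
  assumes "continuous_on S f"
  shows "continuous_on S (\<lambda>x. c *\<^sub>C f x)"
proof (rule continuous_on_compose2[OF _ assms])
  show "continuous_on UNIV (\<lambda>x::'b. c *\<^sub>C x)"
    by (rule continuous_on_clinear[where K = "cmod c"])
      (simp_all add: clinear_iff scaleC_add_right scaleC_scaleC mult.commute norm_scaleC)
qed simp

text \<open>The homomorphism theorem for a map \<open>V \<rightarrow> W/M\<close> that is onto. Preimages of cosets of \<open>M\<close> are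
  cosets of the kernel \<open>N\<close>, so taking preimages is itself the isomorphism; no representatives have
  to be chosen.\<close>

lemma quotient_space_isomorphic_preimage:
  fixes L :: "'v::complex_vector \<Rightarrow> 'w::complex_vector"
  assumes L: "clinear L" and V: "csubspace V" and M: "csubspace M"
    and LV: "L ` V \<subseteq> W"
    and onto: "\<And>w. w \<in> W \<Longrightarrow> \<exists>v\<in>V. w - L v \<in> M"
  shows "W /\<^sub>q M \<cong>\<^sub>C V /\<^sub>q {v \<in> V. L v \<in> M}"
proof -
  define N where "N = {v \<in> V. L v \<in> M}"
  define \<Phi> where "\<Phi> X = {v \<in> V. L v \<in> X}" for X
  have N: "csubspace N"
    unfolding N_def by (rule csubspace_preimage[OF L M V])
  have \<Phi>: "\<Phi> (w +o M) = v +o N" if "v \<in> V" "w - L v \<in> M" for v w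
  proof (intro set_eqI iffI)
    fix u assume "u \<in> \<Phi> (w +o M)"
    then have "u \<in> V" "L u - w \<in> M" by (simp_all add: \<Phi>_def mem_coset_iff)
    then have "u - v \<in> V" "(L u - w) + (w - L v) \<in> M"
      using that V M complex_vector.subspace_diff complex_vector.subspace_add by blast+
    then show "u \<in> v +o N" by (simp add: mem_coset_iff N_def clinear_diff[OF L])
  next
    fix u assume "u \<in> v +o N"
    then have "u - v \<in> V" "L u - L v \<in> M" by (simp_all add: mem_coset_iff N_def clinear_diff[OF L])
    then have "(u - v) + v \<in> V" "(L u - L v) - (w - L v) \<in> M"
      using that V M complex_vector.subspace_diff complex_vector.subspace_add by blast+
    then show "u \<in> \<Phi> (w +o M)" by (simp add: \<Phi>_def mem_coset_iff)
  qed
  have points: "points (W /\<^sub>q M) = (\<lambda>w. w +o M) ` W" "points (V /\<^sub>q N) = (\<lambda>v. v +o N) ` V"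
    by (simp_all add: quotient_space_def)
  have inj: "w +o M = w' +o M" if w: "w \<in> W" "w' \<in> W" "\<Phi> (w +o M) = \<Phi> (w' +o M)" for w w'
  proof -
    obtain v where v: "v \<in> V" "w - L v \<in> M" using onto w(1) by blast
    then have "v \<in> \<Phi> (w +o M)"
      using \<Phi>[OF v] complex_vector.subspace_0[OF N] by (simp add: mem_coset_iff)
    then have "v \<in> \<Phi> (w' +o M)" using w(3) by simp
    then have "L v - w' \<in> M" by (simp add: \<Phi>_def mem_coset_iff)
    then have "(w - L v) + (L v - w') \<in> M" using v(2) M complex_vector.subspace_add by blast
    then show ?thesis by (simp add: coset_eq_iff[OF M])
  qed
  have "bij_betw \<Phi> (points (W /\<^sub>q M)) (points (V /\<^sub>q N))"
    unfolding bij_betw_def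
  proof
    show "inj_on \<Phi> (points (W /\<^sub>q M))"
      using inj by (auto simp: points inj_on_def)
    show "\<Phi> ` points (W /\<^sub>q M) = points (V /\<^sub>q N)"
    proof
      show "\<Phi> ` points (W /\<^sub>q M) \<subseteq> points (V /\<^sub>q N)"
        using onto \<Phi> by (fastforce simp: points)
      have "v +o N = \<Phi> (L v +o M)" if "v \<in> V" for v
        using that \<Phi>[of v "L v"] complex_vector.subspace_0[OF M] by simp
      then show "points (V /\<^sub>q N) \<subseteq> \<Phi> ` points (W /\<^sub>q M)"
        using LV by (auto simp: points)
    qed
  qed
  moreover have "\<Phi> (vadd (W /\<^sub>q M) (u +o M) (w +o M)) = vadd (V /\<^sub>q N) (\<Phi> (u +o M)) (\<Phi> (w +o M))"
    if uw: "u \<in> W" "w \<in> W" for u w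
  proof -
    obtain v v' where v: "v \<in> V" "u - L v \<in> M" and v': "v' \<in> V" "w - L v' \<in> M"
      using onto uw by blast
    have "(u - L v) + (w - L v') \<in> M"
      using v v' M complex_vector.subspace_add by blast
    then have "u + w - L (v + v') \<in> M"
      using L by (simp add: clinear_iff algebra_simps)
    moreover have "v + v' \<in> V"
      using v v' V complex_vector.subspace_add by blast
    ultimately show ?thesis
      using v v' by (simp add: \<Phi> vadd_quotient_space M N)
  qed
  moreover have "\<Phi> (vscale (W /\<^sub>q M) c (w +o M)) = vscale (V /\<^sub>q N) c (\<Phi> (w +o M))"
    if w: "w \<in> W" for c w
  proof -
    obtain v where v: "v \<in> V" "w - L v \<in> M"
      using onto w by blast
    have "c *\<^sub>C w - L (c *\<^sub>C v) = c *\<^sub>C (w - L v)"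
      using L by (simp add: clinear_iff complex_vector.scale_right_diff_distrib)
    then have "c *\<^sub>C w - L (c *\<^sub>C v) \<in> M"
      using v M complex_vector.subspace_scale by metis
    moreover have "c *\<^sub>C v \<in> V"
      using v V complex_vector.subspace_scale by blast
    ultimately show ?thesis
      using v by (simp add: \<Phi> vscale_quotient_space M N)
  qed
  ultimately show ?thesis
    unfolding linear_isomorphic_def N_def[symmetric] by (intro exI[of _ \<Phi>]) (auto simp: points)
qed


section \<open>Spaces of derivations\<close>

lemma csubspace_Z1:
  assumes "\<And>b. clinear (l b)" "\<And>b. clinear (\<lambda>x. r x b)"
  shows "csubspace (Z1 m l r)"
  unfolding csubspace_iff
proof (intro conjI ballI allI)
  show "0 \<in> Z1 m l r"
    using clinear_0[OF assms(1)] clinear_0[OF assms(2)]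
    by (simp add: Z1_def derivation_def clinear_iff zero_fun_def)
next
  fix D E assume "D \<in> Z1 m l r" "E \<in> Z1 m l r"
  then show "D + E \<in> Z1 m l r"
    using assms by (auto simp: Z1_def derivation_def clinear_iff plus_fun_def scaleC_add_right
        intro: continuous_on_add)
next
  fix c D assume "D \<in> Z1 m l r"
  then show "c *\<^sub>C D \<in> Z1 m l r"
    using assms by (auto simp: Z1_def derivation_def clinear_iff scaleC_fun_def scaleC_add_right
        scaleC_scaleC mult.commute intro: continuous_on_scaleC)
qed

lemma csubspace_N1:
  assumes "\<And>b. clinear (l b)" "\<And>b. clinear (\<lambda>x. r x b)"
  shows "csubspace (N1 l r)"
  unfolding N1_def
  using assms by (intro csubspace_range) (simp add: clinear_iff fun_eq_iff inner_derivation_def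
      scaleC_fun_def complex_vector.scale_right_diff_distrib)

lemma banach_bimodule_self:
  "banach_bimodule (*) ((*) :: 'b::complex_banach_algebra \<Rightarrow> 'b \<Rightarrow> 'b)"
  by unfold_locales
    (simp_all add: clinear_iff distrib_left distrib_right mult_scaleC_left mult_scaleC_right
      mult.assoc norm_mult_ineq)

context banach_bimodule
begin

lemmas action_simps =
  clinear_l1[unfolded clinear_iff, THEN conjunct1, rule_format]
  clinear_l1[unfolded clinear_iff, THEN conjunct2, rule_format]
  clinear_l2[unfolded clinear_iff, THEN conjunct1, rule_format]
  clinear_l2[unfolded clinear_iff, THEN conjunct2, rule_format]
  clinear_r1[unfolded clinear_iff, THEN conjunct1, rule_format]
  clinear_r1[unfolded clinear_iff, THEN conjunct2, rule_format]
  clinear_r2[unfolded clinear_iff, THEN conjunct1, rule_format]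
  clinear_r2[unfolded clinear_iff, THEN conjunct2, rule_format]
  clinear_0[OF clinear_l1] clinear_0[OF clinear_l2]
  clinear_0[OF clinear_r1] clinear_0[OF clinear_r2]
  clinear_diff[OF clinear_l1] clinear_diff[OF clinear_l2]
  clinear_diff[OF clinear_r1] clinear_diff[OF clinear_r2]

lemma inner_derivation_in_Z1: "inner_derivation l r x \<in> Z1 (*) l r"
proof -
  have "continuous_on UNIV (\<lambda>b. l b x)" "continuous_on UNIV (\<lambda>b. r x b)"
    using norm_l norm_r
    by (auto intro!: continuous_on_clinear[where K = "norm x"] clinear_l1 clinear_r2
        simp: mult.commute)
  then show ?thesis
    by (auto simp: Z1_def derivation_def inner_derivation_def clinear_iff action_simps
        complex_vector.scale_right_diff_distrib l_mult r_mult l_r intro: continuous_on_diff)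
qed

lemma continuous_on_r_map: "continuous_on UNIV (r_map l r a)"
proof -
  have "continuous_on UNIV (l a)" "continuous_on UNIV (\<lambda>y. r y a)"
    using norm_l norm_r
    by (auto intro!: continuous_on_clinear[where K = "norm a"] clinear_l2 clinear_r1
        simp: mult.commute)
  then show ?thesis
    unfolding r_map_def by (intro continuous_on_diff)
qed

end


section \<open>Derivations of the semidirect product\<close>

text \<open>The lower triangular matrix with diagonal \<open>\<delta>\<^sub>1\<close>, \<open>\<tau>\<close> and lower left entry \<open>\<delta>\<^sub>2\<close>.\<close>

definition sd_map ::
  "('a \<Rightarrow> 'b) \<Rightarrow> ('a \<Rightarrow> 'v) \<Rightarrow> ('u \<Rightarrow> 'v::plus) \<Rightarrow> ('a, 'u) semidirect \<Rightarrow> ('b, 'v) semidirect"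
  where "sd_map \<delta>\<^sub>1 \<delta>\<^sub>2 \<tau> = (\<lambda>p. SD (\<delta>\<^sub>1 (alg_part p)) (\<delta>\<^sub>2 (alg_part p) + \<tau> (mod_part p)))"

lemmas semidirect_ops =
  zero_semidirect_def plus_semidirect_def minus_semidirect_def scaleC_semidirect_def

lemma all_semidirect: "(\<forall>p. P p) \<longleftrightarrow> (\<forall>a x. P (SD a x))"
  by (metis semidirect.exhaust)

lemma sd_map_SD [simp]: "sd_map \<delta>\<^sub>1 \<delta>\<^sub>2 \<tau> (SD a x) = SD (\<delta>\<^sub>1 a) (\<delta>\<^sub>2 a + \<tau> x)"
  by (simp add: sd_map_def)

lemma sd_map_diff:
  fixes \<delta>\<^sub>2 \<epsilon>\<^sub>2 :: "'a \<Rightarrow> 'v::complex_normed_vector"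
    and \<delta>\<^sub>1 \<epsilon>\<^sub>1 :: "'a \<Rightarrow> 'b::complex_normed_vector"
  shows "sd_map \<delta>\<^sub>1 \<delta>\<^sub>2 \<tau> - sd_map \<epsilon>\<^sub>1 \<epsilon>\<^sub>2 \<sigma> = sd_map (\<delta>\<^sub>1 - \<epsilon>\<^sub>1) (\<delta>\<^sub>2 - \<epsilon>\<^sub>2) (\<tau> - \<sigma>)"
  by (simp add: fun_eq_iff sd_map_def semidirect_ops)

lemma sd_map_eq_iff:
  fixes \<delta>\<^sub>2 \<epsilon>\<^sub>2 :: "'a::zero \<Rightarrow> 'v::ab_group_add" and \<tau> \<sigma> :: "'u::zero \<Rightarrow> 'v"
  assumes "\<delta>\<^sub>2 0 = 0" "\<epsilon>\<^sub>2 0 = 0" "\<tau> 0 = 0" "\<sigma> 0 = 0"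
  shows "sd_map \<delta>\<^sub>1 \<delta>\<^sub>2 \<tau> = sd_map \<epsilon>\<^sub>1 \<epsilon>\<^sub>2 \<sigma> \<longleftrightarrow> \<delta>\<^sub>1 = \<epsilon>\<^sub>1 \<and> \<delta>\<^sub>2 = \<epsilon>\<^sub>2 \<and> \<tau> = \<sigma>"
proof
  assume eq: "sd_map \<delta>\<^sub>1 \<delta>\<^sub>2 \<tau> = sd_map \<epsilon>\<^sub>1 \<epsilon>\<^sub>2 \<sigma>"
  have "SD (\<delta>\<^sub>1 a) (\<delta>\<^sub>2 a + \<tau> x) = SD (\<epsilon>\<^sub>1 a) (\<epsilon>\<^sub>2 a + \<sigma> x)" for a x
    using fun_cong[OF eq, of "SD a x"] by simp
  from this[of _ 0] this[of 0] show "\<delta>\<^sub>1 = \<epsilon>\<^sub>1 \<and> \<delta>\<^sub>2 = \<epsilon>\<^sub>2 \<and> \<tau> = \<sigma>"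
    using assms by (simp add: fun_eq_iff)
qed simp

lemma sd_map_of_invariant:
  fixes D :: "('a::complex_normed_vector, 'u::complex_normed_vector) semidirect
    \<Rightarrow> ('b::complex_normed_vector, 'v::complex_normed_vector) semidirect"
  assumes D: "clinear D" and inv: "D ` range (SD 0) \<subseteq> range (SD 0)"
  shows "D = sd_map (\<lambda>a. alg_part (D (SD a 0))) (\<lambda>a. mod_part (D (SD a 0)))
    (\<lambda>x. mod_part (D (SD 0 x)))"
proof
  fix p :: "('a, 'u) semidirect"
  obtain a x where p: "p = SD a x" by (cases p)
  have "SD a x = SD a 0 + SD 0 x" by (simp add: semidirect_ops)
  then have "D p = D (SD a 0) + D (SD 0 x)"
    using D by (simp add: p clinear_iff)
  moreover have "D (SD 0 x) \<in> range (SD 0)"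
    using inv by blast
  then have "alg_part (D (SD 0 x)) = 0"
    by auto
  ultimately show "D p = sd_map (\<lambda>a. alg_part (D (SD a 0))) (\<lambda>a. mod_part (D (SD a 0)))
      (\<lambda>x. mod_part (D (SD 0 x))) p"
    by (simp add: p semidirect_ops)
qed

lemma continuous_on_semidirect:
  fixes T :: "('a::complex_normed_vector, 'u::complex_normed_vector) semidirect set"
  shows "continuous_on T alg_part" "continuous_on T mod_part"
    "continuous_on A (\<lambda>a. SD a 0 :: ('a, 'u) semidirect)"
    "continuous_on U (\<lambda>x. SD 0 x :: ('a, 'u) semidirect)"
  by (rule continuous_on_clinear[where K = 1];
      simp add: clinear_iff semidirect_ops norm_semidirect_def)+

lemma continuous_on_sd_map_iff:
  fixes \<delta>\<^sub>1 :: "'a::complex_normed_vector \<Rightarrow> 'b::complex_normed_vector"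
    and \<delta>\<^sub>2 :: "'a \<Rightarrow> 'v::complex_normed_vector"
    and \<tau> :: "'u::complex_normed_vector \<Rightarrow> 'v"
  assumes "\<delta>\<^sub>2 0 = 0" "\<tau> 0 = 0"
  shows "continuous_on UNIV (sd_map \<delta>\<^sub>1 \<delta>\<^sub>2 \<tau>)
    \<longleftrightarrow> continuous_on UNIV \<delta>\<^sub>1 \<and> continuous_on UNIV \<delta>\<^sub>2 \<and> continuous_on UNIV \<tau>"
proof
  assume cont: "continuous_on UNIV (sd_map \<delta>\<^sub>1 \<delta>\<^sub>2 \<tau>)"
  have left: "continuous_on UNIV (\<lambda>a. sd_map \<delta>\<^sub>1 \<delta>\<^sub>2 \<tau> (SD a 0))"
    by (rule continuous_on_compose2[OF cont continuous_on_semidirect(3)]) simp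
  have right: "continuous_on UNIV (\<lambda>x. sd_map \<delta>\<^sub>1 \<delta>\<^sub>2 \<tau> (SD 0 x))"
    by (rule continuous_on_compose2[OF cont continuous_on_semidirect(4)]) simp
  have "continuous_on UNIV (\<lambda>a. alg_part (sd_map \<delta>\<^sub>1 \<delta>\<^sub>2 \<tau> (SD a 0)))"
    by (rule continuous_on_compose2[OF continuous_on_semidirect(1)[of UNIV] left]) simp
  moreover have "continuous_on UNIV (\<lambda>a. mod_part (sd_map \<delta>\<^sub>1 \<delta>\<^sub>2 \<tau> (SD a 0)))"
    by (rule continuous_on_compose2[OF continuous_on_semidirect(2)[of UNIV] left]) simp
  moreover have "continuous_on UNIV (\<lambda>x. mod_part (sd_map \<delta>\<^sub>1 \<delta>\<^sub>2 \<tau> (SD 0 x)))"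
    by (rule continuous_on_compose2[OF continuous_on_semidirect(2)[of UNIV] right]) simp
  ultimately show "continuous_on UNIV \<delta>\<^sub>1 \<and> continuous_on UNIV \<delta>\<^sub>2 \<and> continuous_on UNIV \<tau>"
    using assms by simp
next
  assume cont: "continuous_on UNIV \<delta>\<^sub>1 \<and> continuous_on UNIV \<delta>\<^sub>2 \<and> continuous_on UNIV \<tau>"
  have \<delta>1: "continuous_on UNIV (\<lambda>p::('a, 'u) semidirect. \<delta>\<^sub>1 (alg_part p))"
    and \<delta>2: "continuous_on UNIV (\<lambda>p::('a, 'u) semidirect. \<delta>\<^sub>2 (alg_part p))"
    and \<tau>: "continuous_on UNIV (\<lambda>p::('a, 'u) semidirect. \<tau> (mod_part p))"
    using cont by (auto intro: continuous_on_compose2 continuous_on_semidirect)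
  have "continuous_on UNIV (\<lambda>p::('a, 'u) semidirect. SD (\<delta>\<^sub>1 (alg_part p)) 0
      + SD 0 (\<delta>\<^sub>2 (alg_part p) + \<tau> (mod_part p)) :: ('b, 'v) semidirect)"
    by (intro continuous_on_add continuous_on_compose2[OF continuous_on_semidirect(3) \<delta>1]
        continuous_on_compose2[OF continuous_on_semidirect(4) continuous_on_add[OF \<delta>2 \<tau>]]) auto
  then show "continuous_on UNIV (sd_map \<delta>\<^sub>1 \<delta>\<^sub>2 \<tau>)"
    by (simp add: sd_map_def semidirect_ops)
qed

lemma clinear_sd_map_iff:
  fixes \<delta>\<^sub>1 :: "'a::complex_normed_vector \<Rightarrow> 'b::complex_normed_vector"
    and \<delta>\<^sub>2 :: "'a \<Rightarrow> 'v::complex_normed_vector"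
    and \<tau> :: "'u::complex_normed_vector \<Rightarrow> 'v"
  assumes "\<delta>\<^sub>2 0 = 0" "\<tau> 0 = 0"
  shows "clinear (sd_map \<delta>\<^sub>1 \<delta>\<^sub>2 \<tau>) \<longleftrightarrow> clinear \<delta>\<^sub>1 \<and> clinear \<delta>\<^sub>2 \<and> clinear \<tau>"
proof
  assume lin: "clinear (sd_map \<delta>\<^sub>1 \<delta>\<^sub>2 \<tau>)"
  have add: "SD (\<delta>\<^sub>1 (a + b)) (\<delta>\<^sub>2 (a + b) + \<tau> (x + y))
      = SD (\<delta>\<^sub>1 a + \<delta>\<^sub>1 b) (\<delta>\<^sub>2 a + \<tau> x + (\<delta>\<^sub>2 b + \<tau> y))" for a b x y
    using lin[unfolded clinear_iff, THEN conjunct1, rule_format, of "SD a x" "SD b y"]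
    by (simp add: semidirect_ops)
  have scale: "SD (\<delta>\<^sub>1 (c *\<^sub>C a)) (\<delta>\<^sub>2 (c *\<^sub>C a) + \<tau> (c *\<^sub>C x))
      = SD (c *\<^sub>C \<delta>\<^sub>1 a) (c *\<^sub>C (\<delta>\<^sub>2 a + \<tau> x))" for c a x
    using lin[unfolded clinear_iff, THEN conjunct2, rule_format, of c "SD a x"]
    by (simp add: semidirect_ops)
  show "clinear \<delta>\<^sub>1 \<and> clinear \<delta>\<^sub>2 \<and> clinear \<tau>"
    using assms add[of _ _ 0 0] add[of 0 0] scale[of _ _ 0] scale[of _ 0]
    by (simp add: clinear_iff)
qed (simp add: clinear_iff sd_map_def semidirect_ops scaleC_add_right)

context compatible_banach_bimodule
begin

text \<open>In the Leibniz rule at \<open>(a, x)\<close> and \<open>(b, y)\<close>, the pairs of components in \<open>\<A>\<close> and in \<open>\<U>\<close>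
  give the rules for \<open>\<delta>\<^sub>1\<close>, \<open>\<delta>\<^sub>2\<close> and \<open>\<tau>\<close>; the mixed pairs measure how far \<open>\<tau>\<close> is from a
  bimodule homomorphism. By bilinearity these cases imply the full rule.\<close>

lemma derivation_sd_map_iff:
  fixes \<delta>\<^sub>1 :: "'a \<Rightarrow> 'a" and \<delta>\<^sub>2 :: "'a \<Rightarrow> 'u" and \<tau> :: "'u \<Rightarrow> 'u"
  assumes zero: "\<delta>\<^sub>2 0 = 0" "\<tau> 0 = 0"
  shows "derivation_sd l r (sd_map \<delta>\<^sub>1 \<delta>\<^sub>2 \<tau>) \<longleftrightarrow>
    derivation (*) (*) (*) \<delta>\<^sub>1 \<and> derivation (*) l r \<delta>\<^sub>2 \<and> derivation (*) (*) (*) \<tau>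
    \<and> (\<forall>a y. \<tau> (l a y) = l a (\<tau> y) + (l (\<delta>\<^sub>1 a) y + \<delta>\<^sub>2 a * y))
    \<and> (\<forall>b x. \<tau> (r x b) = r (\<tau> x) b + (r x (\<delta>\<^sub>1 b) + x * \<delta>\<^sub>2 b))"
    (is "?L \<longleftrightarrow> ?R")
proof
  assume ?L
  then have lin: "clinear \<delta>\<^sub>1" "clinear \<delta>\<^sub>2" "clinear \<tau>"
    by (simp_all add: derivation_def clinear_sd_map_iff[of \<delta>\<^sub>2 \<tau>, OF zero])
  have \<delta>1_0: "\<delta>\<^sub>1 0 = 0" using clinear_0[OF lin(1)] .
  have "\<delta>\<^sub>1 (a * b) = a * \<delta>\<^sub>1 b + \<delta>\<^sub>1 a * b"
    and mod: "\<delta>\<^sub>2 (a * b) + \<tau> (l a y + r x b + x * y)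
      = l a (\<delta>\<^sub>2 b + \<tau> y) + r x (\<delta>\<^sub>1 b) + x * (\<delta>\<^sub>2 b + \<tau> y)
        + (l (\<delta>\<^sub>1 a) y + r (\<delta>\<^sub>2 a + \<tau> x) b + (\<delta>\<^sub>2 a + \<tau> x) * y)" for a x b y
    using \<open>?L\<close>[unfolded derivation_def, THEN conjunct2, rule_format, of "SD a x" "SD b y"]
    by (simp_all add: sd_mult_def semidirect_ops)
  then show ?R
    using mod[where x = 0 and y = 0] mod[where a = 0 and b = 0]
      mod[where x = 0 and b = 0] mod[where a = 0 and y = 0]
    by (simp add: derivation_def lin zero \<delta>1_0 action_simps algebra_simps)
next
  assume R: ?R
  then have "clinear (sd_map \<delta>\<^sub>1 \<delta>\<^sub>2 \<tau>)" "clinear \<tau>"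
    by (simp_all add: derivation_def clinear_sd_map_iff[of \<delta>\<^sub>2 \<tau>, OF zero])
  then show ?L
    using R by (simp add: derivation_def all_semidirect sd_mult_def semidirect_ops
        clinear_iff[of \<tau>] action_simps algebra_simps)
qed

lemma inner_derivation_sd:
  "inner_derivation (sd_mult l r) (sd_mult l r) (SD a x)
    = sd_map (inner_derivation (*) (*) a) (inner_derivation l r x)
        (r_map l r a + inner_derivation (*) (*) x)"
  by (simp add: fun_eq_iff all_semidirect inner_derivation_def sd_mult_def semidirect_ops r_map_def)

lemma r_map_inner_derivation_in_Z1: "r_map l r a + inner_derivation (*) (*) x \<in> Z1_self"
proof -
  have "derivation (*) (*) (*) (r_map l r a)"
    by (simp add: derivation_def clinear_iff r_map_def action_simps
        complex_vector.scale_right_diff_distrib algebra_simps l_times times_r r_times_l)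
  then have "r_map l r a \<in> Z1_self"
    by (simp add: Z1_def continuous_on_r_map)
  moreover have "inner_derivation (*) (*) x \<in> (Z1_self :: ('u \<Rightarrow> 'u) set)"
    by (rule banach_bimodule.inner_derivation_in_Z1[OF banach_bimodule_self])
  moreover have "csubspace (Z1_self :: ('u \<Rightarrow> 'u) set)"
    using banach_bimodule_self banach_bimodule.clinear_l2 banach_bimodule.clinear_r1
    by (intro csubspace_Z1) blast+
  ultimately show ?thesis
    using complex_vector.subspace_add by blast
qed

end


section \<open>Derivations with values in annihilators\<close>

locale annihilating_bimodule = compatible_banach_bimodule l r
  for l :: "'a::complex_banach_algebra \<Rightarrow> 'u \<Rightarrow> 'u::complex_banach_algebra"
    and r :: "'u \<Rightarrow> 'a \<Rightarrow> 'u" +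
  assumes ann1: "\<delta> \<in> Z1_self \<Longrightarrow> range \<delta> \<subseteq> ann_alg l r"
    and ann2: "\<epsilon> \<in> Z1 (*) l r \<Longrightarrow> range \<epsilon> \<subseteq> ann_self"
begin

text \<open>The defect terms in the criterion for triangular maps vanish, which leaves
  independent conditions on the three entries.\<close>

lemma sd_map_in_Z1_iff:
  fixes \<delta>\<^sub>1 :: "'a \<Rightarrow> 'a" and \<delta>\<^sub>2 :: "'a \<Rightarrow> 'u" and \<tau> :: "'u \<Rightarrow> 'u"
  assumes zero: "\<delta>\<^sub>2 0 = 0" "\<tau> 0 = 0"
  shows "sd_map \<delta>\<^sub>1 \<delta>\<^sub>2 \<tau> \<in> Z1 (sd_mult l r) (sd_mult l r) (sd_mult l r)
    \<longleftrightarrow> \<delta>\<^sub>1 \<in> Z1_self \<and> \<delta>\<^sub>2 \<in> Z1 (*) l r \<and> \<tau> \<in> Hom_bimod l r \<inter> Z1_self"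
proof (cases "\<delta>\<^sub>1 \<in> Z1_self \<and> \<delta>\<^sub>2 \<in> Z1 (*) l r")
  case True
  then have "\<delta>\<^sub>1 a \<in> ann_alg l r" "\<delta>\<^sub>2 a \<in> ann_self" for a
    using ann1 ann2 by blast+
  then have "l (\<delta>\<^sub>1 a) x = 0" "r x (\<delta>\<^sub>1 a) = 0" "\<delta>\<^sub>2 a * x = 0" "x * \<delta>\<^sub>2 a = 0" for a x
    by (simp_all add: ann_alg_def ann_self_def)
  then show ?thesis
    using True zero
    by (auto simp: Z1_def derivation_sd_map_iff continuous_on_sd_map_iff Hom_bimod_def
        derivation_def[of _ _ _ \<tau>])
next
  case False
  then show ?thesis
    using zero by (auto simp: Z1_def derivation_sd_map_iff continuous_on_sd_map_iff)
qed

text \<open>The commutator of \<open>a\<close> and \<open>b\<close> is a value of \<open>id\<^sub>a\<close>, and \<open>bx - xb\<close> is a value of \<open>id\<^sub>x\<close>.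
  As both annihilate \<open>\<U>\<close>, commutation with \<open>a\<close> and with \<open>x\<close> respects the action of \<open>b\<close>.\<close>

lemma R_maps_plus_N1_subset: "R_maps l r + N1_self \<subseteq> Hom_bimod l r \<inter> Z1_self"
proof
  fix T assume "T \<in> R_maps l r + N1_self"
  then obtain a x where T: "T = r_map l r a + inner_derivation (*) (*) x"
    by (auto simp: R_maps_def N1_def elim!: set_plus_elim)
  have "T \<in> Z1_self"
    unfolding T by (rule r_map_inner_derivation_in_Z1)
  have "inner_derivation (*) (*) a \<in> (Z1_self :: ('a \<Rightarrow> 'a) set)"
    by (rule banach_bimodule.inner_derivation_in_Z1[OF banach_bimodule_self])
  then have "b * a - a * b \<in> ann_alg l r" for b
    using ann1 by (auto simp: inner_derivation_def)
  then have "l (b * a - a * b) y = 0" "r y (b * a - a * b) = 0" for b y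
    by (simp_all add: ann_alg_def)
  then have alg: "l b (l a y) = l a (l b y)" "r (r y b) a = r (r y a) b" for b y
    by (simp_all add: action_simps l_mult r_mult)
  have "l b x - r x b \<in> ann_self" for b
    using ann2[OF inner_derivation_in_Z1[of x]] by (auto simp: inner_derivation_def)
  then have "(l b x - r x b) * y = 0" "y * (l b x - r x b) = 0" for b y
    by (simp_all add: ann_self_def)
  then have mod: "l b x * y = x * l b y" "y * r x b = y * l b x" for b y
    by (simp_all add: algebra_simps r_times_l)
  have "T \<in> Hom_bimod l r"
    using \<open>T \<in> Z1_self\<close>
    by (simp add: Hom_bimod_def Z1_def derivation_def)
      (simp add: T r_map_def inner_derivation_def action_simps alg mod l_r l_times times_r r_times_l)
  with \<open>T \<in> Z1_self\<close> show "T \<in> Hom_bimod l r \<inter> Z1_self" by blast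
qed

text \<open>The entries of a triangular map are determined by the map. So \<open>(\<delta>\<^sub>1, \<delta>\<^sub>2, 0)\<close> equals the inner
  derivation given by \<open>(a, x)\<close> only if \<open>\<delta>\<^sub>1 = id\<^sub>a\<close>, \<open>\<delta>\<^sub>2 = id\<^sub>x\<close> and \<open>0 = r\<^sub>a + id\<^sub>x\<close>. This makes
  \<open>\<K>\<close> the kernel of the map to cohomology, and in particular a subspace.\<close>

lemma K_space_eq_preimage:
  "K_space l r = {v \<in> Z1_self \<times> Z1 (*) l r.
    (case v of (\<delta>\<^sub>1, \<delta>\<^sub>2) \<Rightarrow> sd_map \<delta>\<^sub>1 \<delta>\<^sub>2 0) \<in> N1 (sd_mult l r) (sd_mult l r)}"
    (is "_ = ?P")
proof
  have "(inner_derivation (*) (*) a, inner_derivation l r x) \<in> ?P"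
    if "r_map l r a + inner_derivation (*) (*) x = 0" for a x
  proof -
    have "inner_derivation (sd_mult l r) (sd_mult l r) (SD a x)
        = sd_map (inner_derivation (*) (*) a) (inner_derivation l r x) 0"
      using that by (simp add: inner_derivation_sd)
    then have "sd_map (inner_derivation (*) (*) a) (inner_derivation l r x) 0
        \<in> N1 (sd_mult l r) (sd_mult l r)"
      unfolding N1_def by (metis rangeI)
    then show ?thesis
      by (simp add: inner_derivation_in_Z1
          banach_bimodule.inner_derivation_in_Z1[OF banach_bimodule_self])
  qed
  then show "K_space l r \<subseteq> ?P"
    unfolding K_space_def by blast
  show "?P \<subseteq> K_space l r"
  proof clarify
    fix \<delta>\<^sub>1 \<delta>\<^sub>2 assume \<delta>: "\<delta>\<^sub>2 \<in> Z1 (*) l r"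
      and N: "sd_map \<delta>\<^sub>1 \<delta>\<^sub>2 0 \<in> N1 (sd_mult l r) (sd_mult l r)"
    obtain p where "sd_map \<delta>\<^sub>1 \<delta>\<^sub>2 0 = inner_derivation (sd_mult l r) (sd_mult l r) p"
      using N by (auto simp: N1_def)
    moreover obtain a x where "p = SD a x" by (cases p)
    ultimately have "sd_map \<delta>\<^sub>1 \<delta>\<^sub>2 0 = sd_map (inner_derivation (*) (*) a) (inner_derivation l r x)
        (r_map l r a + inner_derivation (*) (*) x)"
      by (simp add: inner_derivation_sd)
    moreover have "\<delta>\<^sub>2 0 = 0"
      using \<delta> by (simp add: Z1_def derivation_def clinear_0)
    ultimately have "\<delta>\<^sub>1 = inner_derivation (*) (*) a \<and> \<delta>\<^sub>2 = inner_derivation l r x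
        \<and> 0 = r_map l r a + inner_derivation (*) (*) x"
      by (subst (asm) sd_map_eq_iff) (simp_all add: inner_derivation_def r_map_def action_simps)
    then show "(\<delta>\<^sub>1, \<delta>\<^sub>2) \<in> K_space l r"
      unfolding K_space_def by force
  qed
qed

end


section \<open>The first cohomology of the semidirect product\<close>

theorem theorem4p7:
  fixes l :: "'a::complex_banach_algebra \<Rightarrow> 'u::complex_banach_algebra \<Rightarrow> 'u"
    and r :: "'u \<Rightarrow> 'a \<Rightarrow> 'u"
  assumes "compatible_banach_bimodule l r"
    and "\<And>D. derivation_sd l r D \<Longrightarrow> D ` range (SD 0) \<subseteq> range (SD 0)"
    and "\<And>\<delta>. \<delta> \<in> Z1_self \<Longrightarrow> range \<delta> \<subseteq> ann_alg l r"
    and "\<And>\<delta>. \<delta> \<in> Z1 (*) l r \<Longrightarrow> range \<delta> \<subseteq> ann_self"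
    and "points ((Hom_bimod l r \<inter> Z1_self) /\<^sub>q (R_maps l r + N1_self)) = {R_maps l r + N1_self}"
  shows "R_maps l r + N1_self \<subseteq> Hom_bimod l r \<inter> Z1_self
    \<and> csubspace (K_space l r) \<and> K_space l r \<subseteq> Z1_self \<times> Z1 (*) l r
    \<and> H1_sd l r \<cong>\<^sub>C (Z1_self \<times> Z1 (*) l r) /\<^sub>q K_space l r"
proof -
  interpret annihilating_bimodule l r
    using assms(1,3,4)
    by (intro annihilating_bimodule.intro annihilating_bimodule_axioms.intro) auto
  let ?m = "sd_mult l r"
  define L :: "('a \<Rightarrow> 'a) \<times> ('a \<Rightarrow> 'u) \<Rightarrow> ('a, 'u) semidirect \<Rightarrow> ('a, 'u) semidirect"
    where "L = (\<lambda>(\<delta>\<^sub>1, \<delta>\<^sub>2). sd_map \<delta>\<^sub>1 \<delta>\<^sub>2 0)"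
  have L: "clinear L"
    by (auto simp: clinear_iff L_def fun_eq_iff sd_map_def semidirect_ops scaleC_fun_def
        scaleC_prod_def)
  have V: "csubspace (Z1_self \<times> Z1 (*) l r)"
    using banach_bimodule_self banach_bimodule.clinear_l2 banach_bimodule.clinear_r1
    by (intro csubspace_Times csubspace_Z1 clinear_l2 clinear_r1) blast+
  have M: "csubspace (N1 ?m ?m)"
    by (rule csubspace_N1)
      (simp_all add: clinear_iff sd_mult_def semidirect_ops action_simps scaleC_add_right
        mult_scaleC_left mult_scaleC_right algebra_simps)
  have K: "K_space l r = {v \<in> Z1_self \<times> Z1 (*) l r. L v \<in> N1 ?m ?m}"
    unfolding L_def by (rule K_space_eq_preimage)
  have "L ` (Z1_self \<times> Z1 (*) l r) \<subseteq> Z1 ?m ?m ?m"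
  proof clarify
    fix \<delta>\<^sub>1 :: "'a \<Rightarrow> 'a" and \<delta>\<^sub>2 assume \<delta>: "\<delta>\<^sub>1 \<in> Z1_self" "\<delta>\<^sub>2 \<in> Z1 (*) l r"
    have "(0 :: 'u \<Rightarrow> 'u) \<in> Z1_self"
      by (simp add: Z1_def derivation_def clinear_iff zero_fun_def)
    moreover have "0 \<in> Hom_bimod l r"
      by (simp add: Hom_bimod_def clinear_iff zero_fun_def action_simps)
    moreover have "\<delta>\<^sub>2 0 = 0"
      using \<delta>(2) by (simp add: Z1_def derivation_def clinear_0)
    ultimately show "L (\<delta>\<^sub>1, \<delta>\<^sub>2) \<in> Z1 ?m ?m ?m"
      using \<delta> by (simp add: L_def sd_map_in_Z1_iff)
  qed
  moreover have "\<exists>v\<in>Z1_self \<times> Z1 (*) l r. D - L v \<in> N1 ?m ?m" if D: "D \<in> Z1 ?m ?m ?m" for D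
  proof -
    define \<delta>\<^sub>1 where "\<delta>\<^sub>1 = (\<lambda>a. alg_part (D (SD a 0)))"
    define \<delta>\<^sub>2 where "\<delta>\<^sub>2 = (\<lambda>a. mod_part (D (SD a 0)))"
    define \<tau> where "\<tau> = (\<lambda>x. mod_part (D (SD 0 x)))"
    have der: "derivation_sd l r D" and lin: "clinear D"
      using D by (simp_all add: Z1_def derivation_def)
    have D_eq: "D = sd_map \<delta>\<^sub>1 \<delta>\<^sub>2 \<tau>"
      unfolding \<delta>\<^sub>1_def \<delta>\<^sub>2_def \<tau>_def by (rule sd_map_of_invariant[OF lin assms(2)[OF der]])
    have "\<delta>\<^sub>2 0 = 0" "\<tau> 0 = 0"
      using clinear_0[OF lin] by (simp_all add: \<delta>\<^sub>2_def \<tau>_def semidirect_ops)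
    then have \<delta>: "\<delta>\<^sub>1 \<in> Z1_self" "\<delta>\<^sub>2 \<in> Z1 (*) l r" and \<tau>: "\<tau> \<in> Hom_bimod l r \<inter> Z1_self"
      using D unfolding D_eq by (simp_all add: sd_map_in_Z1_iff)
    \<comment> \<open>The only coset is the subspace itself, and \<open>\<tau>\<close> lies in its own coset because the subspace
      contains \<open>0\<close>.\<close>
    have "\<tau> +o (R_maps l r + N1_self) = R_maps l r + N1_self"
      using assms(5) \<tau> unfolding quotient_space_def by auto
    moreover have "0 \<in> R_maps l r" "(0 :: 'u \<Rightarrow> 'u) \<in> N1_self"
      by (auto simp: R_maps_def N1_def r_map_def inner_derivation_def fun_eq_iff action_simps
          intro!: range_eqI[of _ _ 0])
    then have "0 + 0 \<in> R_maps l r + (N1_self :: ('u \<Rightarrow> 'u) set)"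
      by (rule set_plus_intro)
    then have "\<tau> \<in> \<tau> +o (R_maps l r + N1_self)"
      by (simp add: mem_coset_iff)
    ultimately have "\<tau> \<in> R_maps l r + N1_self"
      by simp
    then obtain a x where \<tau>_eq: "\<tau> = r_map l r a + inner_derivation (*) (*) x"
      by (auto simp: R_maps_def N1_def elim!: set_plus_elim)
    let ?v = "(\<delta>\<^sub>1, \<delta>\<^sub>2) - (inner_derivation (*) (*) a, inner_derivation l r x)"
    have "?v \<in> Z1_self \<times> Z1 (*) l r"
      using \<delta> inner_derivation_in_Z1 banach_bimodule.inner_derivation_in_Z1[OF banach_bimodule_self]
      by (intro complex_vector.subspace_diff[OF V]) auto
    moreover have "D - L ?v = inner_derivation ?m ?m (SD a x)"
      by (simp add: D_eq L_def inner_derivation_sd sd_map_diff \<tau>_eq)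
    then have "D - L ?v \<in> N1 ?m ?m"
      by (simp add: N1_def)
    ultimately show ?thesis by (rule rev_bexI)
  qed
  ultimately have "H1_sd l r \<cong>\<^sub>C (Z1_self \<times> Z1 (*) l r) /\<^sub>q K_space l r"
    unfolding H1_def K by (rule quotient_space_isomorphic_preimage[OF L V M])
  moreover have "csubspace (K_space l r)"
    unfolding K by (rule csubspace_preimage[OF L M V])
  moreover have "K_space l r \<subseteq> Z1_self \<times> Z1 (*) l r"
    unfolding K by blast
  ultimately show ?thesis
    using R_maps_plus_N1_subset by blast
qed

end
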